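(* Under the hard-cluster community model with parameters $(n,k,\tau)$, as $n\to\infty$, each of the following conditions implies the impossibility of weak detection: (i) $k=c\log n$ for a constant $c>0$ and a constant $\tau>e^{-2/c}$; (ii) $k=o(\sqrt n)$ and $\tau\ge\exp\left(-\frac{(2-\epsilon)\log(n/k^2)}{k-1}\right)$ for a constant $\epsilon>0$; (iii) $k=\omega(\log n)$ and $\tau\ge1-\frac{2(1-\epsilon)}{k-1}\log\left(1+\frac{\epsilon_n n}{k^2}\right)$ for a constant $\epsilon>0$ and a sequence of positive numbers $\epsilon_n$ with $\epsilon_n\to0$.
   Context: Hard-cluster community model $(n,k,\tau)$, with $2\le k\le n$ an integer and $\tau\in(0,1)$ (both possibly depending on $n$): a symmetric array of angles $X=(X_{ij})_{1\le i<j\le n}$, $X_{ij}=X_{ji}\in[0,2\pi)$, is observed, viewed as labels $X_e$ on the edges $e=\{i,j\}$ of the complete graph on $[n]$. For $C\subset[n]$, $E(C)$ is the set of edges with both endpoints in $C$. Under $H_0$ (law $\mathbb{Q}$) the $X_{ij}$, $i<j$, are i.i.d. uniform on $[0,2\pi)$. Under $H_1$ (law $\mathbb{P}$), a community $C^*\subset[n]$ is drawn uniformly at random among subsets of size $k$, a phase $\Theta^*$ is drawn independently and uniformly on $[0,2\pi)$, and given $(C^*,\Theta^* )$ the labels are independent with $X_e$ uniform on the arc $[\Theta^*,\Theta^*+2\pi\tau]$ (mod $2\pi$) for $e\in E(C^* )$ and $X_e$ uniform on $[0,2\pi)$ for all other edges. $\mathbb{P}$ is the resulting mixture law of $X$.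 $k=c\log n$ is understood up to rounding to an integer; $k=\omega(\log n)$ means $k/\log n\to\infty$; $\log$ is the natural logarithm. A test is a measurable function $\phi$ of the data with values in $\{0,1\}$ ($1$ means reject $H_0$). $p_{\mathrm{fa}}(\phi)=\mathbb{Q}\{\phi(X)=1\}$ and $p_{\mathrm{miss}}(\phi)=\mathbb{P}\{\phi(X)=0\}$. Weak detection is impossible if every sequence of tests satisfies $p_{\mathrm{fa}}+p_{\mathrm{miss}}\ge 1-o(1)$; equivalently the total variation distance between $\mathbb{P}$ and $\mathbb{Q}$ tends to $0$. *)

theory Defs
  imports "HOL-Probability.Probability"
begin

definition edges :: "nat set \<Rightarrow> nat set set" where
  "edges C = {e. e \<subseteq> C \<and> card e = 2}"

definition angle_space :: "real measure" where
  "angle_space = restrict_space lborel {0..<2 * pi}"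

text \<open>The arc \<open>[\<theta>, \<theta> + 2 \<pi> \<tau>]\<close> modulo \<open>2 \<pi>\<close>, with every angle represented in \<open>[0, 2 \<pi>)\<close>.\<close>

definition angle_arc :: "real \<Rightarrow> real \<Rightarrow> real set" where
  "angle_arc \<theta> \<tau> = {x \<in> {0..<2 * pi}.
     \<exists>m::int. \<theta> \<le> x + 2 * pi * of_int m \<and> x + 2 * pi * of_int m \<le> \<theta> + 2 * pi * \<tau>}"

definition uniform_angle :: "real measure" where
  "uniform_angle = uniform_measure angle_space {0..<2 * pi}"

definition uniform_arc :: "real \<Rightarrow> real \<Rightarrow> real measure" where
  "uniform_arc \<theta> \<tau> = uniform_measure angle_space (angle_arc \<theta> \<tau>)"

definition data_space :: "nat \<Rightarrow> (nat set \<Rightarrow> real) measure" where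
  "data_space n = PiM (edges {1..n}) (\<lambda>_. angle_space)"

definition null_law :: "nat \<Rightarrow> (nat set \<Rightarrow> real) measure" where
  "null_law n = PiM (edges {1..n}) (\<lambda>_. uniform_angle)"

definition community_law :: "nat \<Rightarrow> nat \<Rightarrow> nat set pmf" where
  "community_law n k = pmf_of_set {C. C \<subseteq> {1..n} \<and> card C = k}"

definition planted_law_given :: "nat \<Rightarrow> real \<Rightarrow> nat set \<Rightarrow> real \<Rightarrow> (nat set \<Rightarrow> real) measure" where
  "planted_law_given n \<tau> C \<theta> =
     PiM (edges {1..n}) (\<lambda>e. if e \<in> edges C then uniform_arc \<theta> \<tau> else uniform_angle)"

definition planted_law :: "nat \<Rightarrow> nat \<Rightarrow> real \<Rightarrow> (nat set \<Rightarrow> real) measure" where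
  "planted_law n k \<tau> =
     measure_pmf (community_law n k) \<bind> (\<lambda>C. uniform_angle \<bind> planted_law_given n \<tau> C)"

text \<open>Well-definedness: for \<open>0 < \<tau> < 1\<close> the conditional laws form a probability kernel, so that the
  binds above are genuine mixtures.\<close>

lemma finite_edges: "finite C \<Longrightarrow> finite (edges C)"
  by (simp add: edges_def)

lemma space_angle_space: "space angle_space = {0..<2 * pi}"
  by (simp add: angle_space_def space_restrict_space)

lemma sets_angle_space: "A \<in> sets angle_space \<longleftrightarrow> A \<in> sets borel \<and> A \<subseteq> {0..<2 * pi}"
  unfolding angle_space_def by (subst sets_restrict_space_iff) auto

lemma emeasure_angle_space: "A \<subseteq> {0..<2 * pi} \<Longrightarrow> emeasure angle_space A = emeasure lborel A"
  unfolding angle_space_def by (subst emeasure_restrict_space) auto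

lemma sets_uniform_angle [measurable_cong]: "sets uniform_angle = sets angle_space"
  by (simp add: uniform_angle_def)

lemma sets_uniform_arc [measurable_cong]: "sets (uniform_arc \<theta> \<tau>) = sets angle_space"
  by (simp add: uniform_arc_def)

lemma pred_angle_arc:
  "Measurable.pred (borel \<Otimes>\<^sub>M borel) (\<lambda>p. snd p \<in> angle_arc (fst p) \<tau>)"
  unfolding angle_arc_def mem_Collect_eq atLeastLessThan_iff by measurable

lemma sets_angle_arc: "angle_arc \<theta> \<tau> \<in> sets borel"
proof -
  have "Measurable.pred borel (\<lambda>x. x \<in> angle_arc \<theta> \<tau>)"
    using measurable_compose[OF _ pred_angle_arc[of \<tau>], of "\<lambda>x. (\<theta>, x)" borel] by simp
  then show ?thesis by (simp add: pred_def)
qed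

lemma angle_arc_subset: "angle_arc \<theta> \<tau> \<subseteq> {0..<2 * pi}"
  by (auto simp: angle_arc_def)

lemma emeasure_angle_arc:
  assumes "\<theta> \<in> {0..<2 * pi}" "0 < \<tau>" "\<tau> < 1"
  shows "emeasure angle_space (angle_arc \<theta> \<tau>) = ennreal (2 * pi * \<tau>)"
proof -
  let ?b = "\<theta> + 2 * pi * \<tau>"
  have pt: "0 < 2 * pi * \<tau>" "2 * pi * \<tau> < 2 * pi" using assms by auto
  have mcase: "m = 0 \<or> m = 1"
    if "0 \<le> x" "x < 2 * pi" "\<theta> \<le> x + 2 * pi * of_int m" "x + 2 * pi * of_int m \<le> ?b" for x and m :: int
  proof -
    have "2 * pi * of_int m > 2 * pi * (-1)" using that(2,3) assms(1) unfolding atLeastLessThan_iff by linarith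
    then have "real_of_int m > -1" by (subst (asm) mult_less_cancel_left_pos) auto
    moreover have "2 * pi * of_int m < 2 * pi * 2" using that(1,4) assms(1) pt unfolding atLeastLessThan_iff by linarith
    then have "real_of_int m < 2" by (subst (asm) mult_less_cancel_left_pos) auto
    ultimately show ?thesis by linarith
  qed
  have eq: "angle_arc \<theta> \<tau> = {x. 0 \<le> x \<and> x < 2 * pi \<and> \<theta> \<le> x \<and> x \<le> ?b}
      \<union> {x. 0 \<le> x \<and> x < 2 * pi \<and> \<theta> \<le> x + 2 * pi \<and> x + 2 * pi \<le> ?b}" (is "_ = ?S")
  proof (intro set_eqI iffI)
    fix x assume "x \<in> angle_arc \<theta> \<tau>"
    then obtain m :: int where m: "0 \<le> x" "x < 2 * pi" "\<theta> \<le> x + 2 * pi * of_int m" "x + 2 * pi * of_int m \<le> ?b"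
      by (auto simp: angle_arc_def)
    with mcase[OF m] show "x \<in> ?S" by auto
  next
    fix x assume "x \<in> ?S"
    then show "x \<in> angle_arc \<theta> \<tau>"
      by (auto simp: angle_arc_def intro: exI[of _ "0::int"] exI[of _ "1::int"])
  qed
  show ?thesis
  proof (cases "?b < 2 * pi")
    case True
    have "angle_arc \<theta> \<tau> = {\<theta>..?b}" unfolding eq using assms(1) True pt by auto
    then show ?thesis using pt
      by (subst emeasure_angle_space[OF angle_arc_subset]) simp
  next
    case False
    have "angle_arc \<theta> \<tau> = {\<theta>..<2 * pi} \<union> {0..?b - 2 * pi}" unfolding eq
    proof (intro set_eqI iffI)
      fix x assume "x \<in> {x. 0 \<le> x \<and> x < 2 * pi \<and> \<theta> \<le> x \<and> x \<le> ?b}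
        \<union> {x. 0 \<le> x \<and> x < 2 * pi \<and> \<theta> \<le> x + 2 * pi \<and> x + 2 * pi \<le> ?b}"
      then show "x \<in> {\<theta>..<2 * pi} \<union> {0..?b - 2 * pi}" by auto
    next
      fix x assume "x \<in> {\<theta>..<2 * pi} \<union> {0..?b - 2 * pi}"
      then consider "\<theta> \<le> x" "x < 2 * pi" | "0 \<le> x" "x \<le> ?b - 2 * pi" by auto
      then show "x \<in> {x. 0 \<le> x \<and> x < 2 * pi \<and> \<theta> \<le> x \<and> x \<le> ?b}
        \<union> {x. 0 \<le> x \<and> x < 2 * pi \<and> \<theta> \<le> x + 2 * pi \<and> x + 2 * pi \<le> ?b}"
      proof cases
        case 1
        with assms(1) False have "0 \<le> x \<and> x \<le> ?b" unfolding atLeastLessThan_iff by linarith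
        with 1 show ?thesis by blast
      next
        case 2
        with assms(1) pt have "x < 2 * pi \<and> \<theta> \<le> x + 2 * pi \<and> x + 2 * pi \<le> ?b"
          unfolding atLeastLessThan_iff by linarith
        with 2 show ?thesis by blast
      qed
    qed
    moreover have "{\<theta>..<2 * pi} \<inter> {0..?b - 2 * pi} = {}" using pt
      by (intro equalityI subsetI) (unfold Int_iff atLeastLessThan_iff atLeastAtMost_iff, linarith, simp)
    ultimately show ?thesis using False assms(1) pt
      by (subst emeasure_angle_space[OF angle_arc_subset])
         (simp add: plus_emeasure[symmetric] ennreal_plus[symmetric] del: ennreal_plus)
  qed
qed

lemma prob_space_uniform_angle: "prob_space uniform_angle"
  unfolding uniform_angle_def
  by (rule prob_space_uniform_measure) (simp_all add: emeasure_angle_space ennreal_eq_0_iff not_le)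

lemma prob_space_uniform_arc:
  assumes "\<theta> \<in> {0..<2 * pi}" "0 < \<tau>" "\<tau> < 1"
  shows "prob_space (uniform_arc \<theta> \<tau>)"
  unfolding uniform_arc_def
  by (rule prob_space_uniform_measure) (use assms in \<open>simp_all add: emeasure_angle_arc ennreal_eq_0_iff not_le\<close>)

lemma emeasure_uniform_arc:
  assumes "\<theta> \<in> {0..<2 * pi}" "0 < \<tau>" "\<tau> < 1" "A \<in> sets angle_space"
  shows "emeasure (uniform_arc \<theta> \<tau>) A = emeasure lborel (angle_arc \<theta> \<tau> \<inter> A) / ennreal (2 * pi * \<tau>)"
proof -
  have "angle_arc \<theta> \<tau> \<in> sets angle_space"
    using sets_angle_arc angle_arc_subset by (auto simp: sets_angle_space)
  then show ?thesis
    using assms angle_arc_subset[of \<theta> \<tau>]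
    by (simp add: uniform_arc_def emeasure_angle_arc)
       (subst emeasure_angle_space, auto)
qed

lemma planted_law_given_kernel:
  assumes \<tau>: "0 < \<tau>" "\<tau> < 1"
  shows "planted_law_given n \<tau> C \<in> uniform_angle \<rightarrow>\<^sub>M prob_algebra (data_space n)"
proof (rule measurable_prob_algebra_generated)
  let ?I = "edges {1..n}"
  let ?M = "\<lambda>\<theta> e. if e \<in> edges C then uniform_arc \<theta> \<tau> else uniform_angle"
  show "sets (data_space n) = sigma_sets (\<Pi>\<^sub>E i\<in>?I. space angle_space) (prod_algebra ?I (\<lambda>_. angle_space))"
    by (simp add: data_space_def sets_PiM)
  show "Int_stable (prod_algebra ?I (\<lambda>_. angle_space))" by (rule Int_stable_prod_algebra)
  show "prod_algebra ?I (\<lambda>_. angle_space) \<subseteq> Pow (\<Pi>\<^sub>E i\<in>?I. space angle_space)"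
    by (rule prod_algebra_sets_into_space)
  have sp: "\<theta> \<in> {0..<2 * pi}" if "\<theta> \<in> space uniform_angle" for \<theta>
    using that by (simp add: uniform_angle_def space_angle_space)
  show "prob_space (planted_law_given n \<tau> C \<theta>)" if "\<theta> \<in> space uniform_angle" for \<theta>
    unfolding planted_law_given_def
    by (rule prob_space_PiM) (simp add: prob_space_uniform_angle prob_space_uniform_arc[OF sp[OF that] \<tau>])
  show "sets (planted_law_given n \<tau> C \<theta>) = sets (data_space n)" for \<theta>
    unfolding planted_law_given_def data_space_def
    by (rule sets_PiM_cong) (auto simp: sets_uniform_angle sets_uniform_arc)
  fix A assume A: "A \<in> prod_algebra ?I (\<lambda>_. angle_space)"
  obtain X where X1: "A = Pi\<^sub>E ?I X" and X2: "X \<in> (\<Pi> i\<in>?I. sets angle_space)"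
    by (rule prod_algebraE_all[OF A])
  note X = X1 Pi_mem[OF X2]
  have fin: "emeasure (planted_law_given n \<tau> C \<theta>) A = (\<Prod>e\<in>?I. emeasure (?M \<theta> e) (X e))"
    if "\<theta> \<in> space uniform_angle" for \<theta>
  proof -
    interpret product_sigma_finite "?M \<theta>"
      by (rule product_sigma_finite.intro) (simp add: prob_space_imp_sigma_finite prob_space_uniform_angle
        prob_space_uniform_arc[OF sp[OF that] \<tau>])
    show ?thesis unfolding planted_law_given_def X(1)
      by (rule emeasure_PiM) (use X(2) in \<open>auto simp: finite_edges sets_uniform_angle sets_uniform_arc\<close>)
  qed
  have m: "(\<lambda>\<theta>. emeasure (?M \<theta> e) (X e)) \<in> borel_measurable uniform_angle" if "e \<in> ?I" for e
  proof (cases "e \<in> edges C")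
    case True
    have [measurable]: "X e \<in> sets borel" using X(2)[OF that] by (simp add: sets_angle_space)
    have "Measurable.pred (borel \<Otimes>\<^sub>M borel) (\<lambda>p. snd p \<in> angle_arc (fst p) \<tau> \<and> snd p \<in> X e)"
      using pred_angle_arc[of \<tau>] by measurable
    then have "{p \<in> space (borel \<Otimes>\<^sub>M lborel). snd p \<in> angle_arc (fst p) \<tau> \<inter> X e} \<in> sets (borel \<Otimes>\<^sub>M lborel)"
      by (simp add: pred_def space_pair_measure cong: sets_pair_measure_cong)
    then have "(\<lambda>\<theta>. emeasure lborel (angle_arc \<theta> \<tau> \<inter> X e)) \<in> borel_measurable (borel :: real measure)"
      by (intro lborel.measurable_emeasure) auto
    then have "(\<lambda>\<theta>. emeasure lborel (angle_arc \<theta> \<tau> \<inter> X e)) \<in> borel_measurable uniform_angle"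
      unfolding measurable_cong_sets[OF sets_uniform_angle refl] angle_space_def
      by (intro measurable_restrict_space1) (simp add: measurable_lborel1)
    then have "(\<lambda>\<theta>. emeasure lborel (angle_arc \<theta> \<tau> \<inter> X e) / ennreal (2 * pi * \<tau>)) \<in> borel_measurable uniform_angle"
      by measurable
    then show ?thesis
      by (subst measurable_cong[where g="\<lambda>\<theta>. emeasure lborel (angle_arc \<theta> \<tau> \<inter> X e) / ennreal (2 * pi * \<tau>)"])
         (use True X(2)[OF that] in \<open>simp_all add: emeasure_uniform_arc[OF sp \<tau>]\<close>)
  qed simp
  show "(\<lambda>\<theta>. emeasure (planted_law_given n \<tau> C \<theta>) A) \<in> borel_measurable uniform_angle"
    by (subst measurable_cong[OF fin]) (auto intro!: borel_measurable_prod_ennreal m)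
qed

lemma
  assumes "0 < \<tau>" "\<tau> < 1"
  shows prob_space_planted_law: "prob_space (planted_law n k \<tau>)"
    and sets_planted_law: "sets (planted_law n k \<tau>) = sets (data_space n)"
    and emeasure_planted_law: "A \<in> sets (data_space n) \<Longrightarrow> emeasure (planted_law n k \<tau>) A =
      (\<integral>\<^sup>+C. \<integral>\<^sup>+\<theta>. emeasure (planted_law_given n \<tau> C \<theta>) A \<partial>uniform_angle \<partial>community_law n k)"
proof -
  have u: "uniform_angle \<in> space (prob_algebra uniform_angle)"
    by (simp add: space_prob_algebra prob_space_uniform_angle)
  note k = planted_law_given_kernel[OF assms, of n]
  have inner: "uniform_angle \<bind> planted_law_given n \<tau> C \<in> space (prob_algebra (data_space n))" for C
    using prob_space_bind'[OF u k] sets_bind'[OF u k] by (simp add: space_prob_algebra)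
  have p: "measure_pmf (community_law n k) \<in> space (prob_algebra (count_space UNIV))"
    by (simp add: space_prob_algebra measure_pmf.prob_space_axioms)
  have outer: "(\<lambda>C. uniform_angle \<bind> planted_law_given n \<tau> C) \<in> count_space UNIV \<rightarrow>\<^sub>M prob_algebra (data_space n)"
    using inner by simp
  show "prob_space (planted_law n k \<tau>)" "sets (planted_law n k \<tau>) = sets (data_space n)"
    unfolding planted_law_def using prob_space_bind'[OF p outer] sets_bind'[OF p outer] by auto
  show "emeasure (planted_law n k \<tau>) A =
      (\<integral>\<^sup>+C. \<integral>\<^sup>+\<theta>. emeasure (planted_law_given n \<tau> C \<theta>) A \<partial>uniform_angle \<partial>community_law n k)"
    if "A \<in> sets (data_space n)"
    unfolding planted_law_def
    by (simp add: emeasure_bind_prob_algebra[OF p outer that] emeasure_bind_prob_algebra[OF u k that])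
qed

text \<open>A test rejects the null hypothesis where it is \<open>True\<close>.\<close>

definition is_test :: "nat \<Rightarrow> ((nat set \<Rightarrow> real) \<Rightarrow> bool) \<Rightarrow> bool" where
  "is_test n \<phi> \<longleftrightarrow> \<phi> \<in> data_space n \<rightarrow>\<^sub>M count_space UNIV"

definition p_fa :: "nat \<Rightarrow> ((nat set \<Rightarrow> real) \<Rightarrow> bool) \<Rightarrow> real" where
  "p_fa n \<phi> = measure (null_law n) {x \<in> space (data_space n). \<phi> x}"

definition p_miss :: "nat \<Rightarrow> nat \<Rightarrow> real \<Rightarrow> ((nat set \<Rightarrow> real) \<Rightarrow> bool) \<Rightarrow> real" where
  "p_miss n k \<tau> \<phi> = measure (planted_law n k \<tau>) {x \<in> space (data_space n). \<not> \<phi> x}"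

definition weak_detection_impossible :: "(nat \<Rightarrow> nat) \<Rightarrow> (nat \<Rightarrow> real) \<Rightarrow> bool" where
  "weak_detection_impossible k \<tau> \<longleftrightarrow>
     (\<forall>\<phi>. (\<forall>n. is_test n (\<phi> n)) \<longrightarrow>
       (\<exists>\<delta>. \<delta> \<longlonglongrightarrow> 0 \<and>
         (\<forall>\<^sub>F n in sequentially. p_fa n (\<phi> n) + p_miss n (k n) (\<tau> n) (\<phi> n) \<ge> 1 - \<delta> n)))"

end

theory Submission
  imports Defs "HOL-Real_Asymp.Real_Asymp"
begin

text \<open>
  The proof is a second moment computation, carried out for each phase separately. Given the phase
  \<open>\<theta>\<close>, the planted law with community \<open>C\<close> is the null law conditioned on the event \<open>A\<^sub>C\<close> that every edge
  inside \<open>C\<close> has its label in the arc (\<open>planted_law_given_eq_conditional\<close>). Averaging over \<open>C\<close> gives a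
  mixture whose likelihood ratio \<open>L\<close> against the null law \<open>Q\<close> has second moment equal to the average,
  over two independent communities \<open>C\<close> and \<open>D\<close>, of
  \<open>Q(A\<^sub>C \<inter> A\<^sub>D) / (Q(A\<^sub>C) Q(A\<^sub>D)) = \<tau> powr (- h (h - 1) / 2)\<close>, where \<open>h = card (C \<inter> D)\<close>.

  Since \<open>h - 1 \<le> k - 1\<close>, this is at most \<open>z ^ h\<close> with \<open>z = \<tau> powr (- (k - 1) / 2)\<close>. The overlap \<open>h\<close> is
  hypergeometric, and its generating function is dominated by that of a binomial variable with \<open>k\<close> trials
  and success probability \<open>k / n\<close>, so the second moment is at most \<open>exp (k\<^sup>2 / n * (z - 1))\<close>
  (\<open>overlap_generating_function_le\<close>). By Cauchy-Schwarz, the errors of any test for the phase \<open>\<theta>\<close> add up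
  to at least \<open>1 - sqrt (exp (k\<^sup>2 / n * (z - 1)) - 1)\<close>. This bound does not depend on \<open>\<theta>\<close>, hence it survives
  averaging over the phase, and weak detection is impossible as soon as \<open>k\<^sup>2 / n * (z - 1)\<close> tends to \<open>0\<close> (\<open>weak_detection_impossibleI\<close>).

  Each of the three regimes implies this single criterion. If \<open>k = o(sqrt n)\<close>, write \<open>q = k\<^sup>2 / n\<close>; the
  hypothesis on \<open>\<tau>\<close> says \<open>z \<le> q powr (- (1 - \<epsilon> / 2))\<close>, so that \<open>q * z \<le> q powr (\<epsilon> / 2)\<close>. The
  logarithmic regime is a special case of this one because \<open>ln (n / k\<^sup>2) / (k - 1)\<close> tends to \<open>1 / c\<close>. In
  the third regime \<open>\<tau>\<close> tends to \<open>1\<close>, because \<open>k\<close> grows faster than \<open>ln n\<close>. It therefore exceeds \<open>1 - \<epsilon>\<close>, so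
  \<open>- ln \<tau>\<close> exceeds \<open>1 - \<tau>\<close> by a factor of at most \<open>1 / (1 - \<epsilon>)\<close>; the hypothesis then gives
  \<open>z \<le> 1 + \<epsilon>\<^sub>n n / k\<^sup>2\<close>, which is the criterion with \<open>k\<^sup>2 / n * (z - 1) \<le> \<epsilon>\<^sub>n\<close>.
\<close>

section \<open>The overlap of two random communities\<close>

text \<open>A fixed \<open>s\<close>-set lies in a uniformly random \<open>k\<close>-subset of an \<open>n\<close>-set with probability
  \<open>(k / n) ((k - 1) / (n - 1)) \<cdots> ((k - s + 1) / (n - s + 1))\<close>, and no factor exceeds the first.\<close>

lemma binomial_shift_le:
  assumes "s \<le> k" "k \<le> n"
  shows "real ((n - s) choose (k - s)) \<le> real (n choose k) * (real k / real n) ^ s"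
  using assms(1)
proof (induction s)
  case 0
  then show ?case by simp
next
  case (Suc s)
  have pos: "0 < k - s" "0 < n - s" "0 < n" using Suc.prems assms(2) by auto
  have "(k - s) * ((n - s) choose (k - s)) = (n - s) * ((n - Suc s) choose (k - Suc s))"
    using times_binomial_minus1_eq[of "k - s" "n - s"] pos(1) by simp
  then have "real (k - s) * real ((n - s) choose (k - s))
      = real (n - s) * real ((n - Suc s) choose (k - Suc s))"
    by (metis of_nat_mult)
  then have "real ((n - Suc s) choose (k - Suc s))
      = real (k - s) / real (n - s) * real ((n - s) choose (k - s))"
    using pos by (simp add: field_simps)
  also have "\<dots> \<le> real k / real n * (real (n choose k) * (real k / real n) ^ s)"
  proof (rule mult_mono)
    have "real s * real k \<le> real s * real n" using assms(2) by (intro mult_left_mono) auto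
    then show "real (k - s) / real (n - s) \<le> real k / real n"
      using pos Suc.prems assms(2) by (simp add: field_simps of_nat_diff)
  qed (use Suc in auto)
  finally show ?case by (simp add: mult_ac)
qed

lemma card_supersets:
  assumes "finite V" "S \<subseteq> V" "card S \<le> k"
  shows "card {C. C \<subseteq> V \<and> card C = k \<and> S \<subseteq> C} = (card V - card S) choose (k - card S)"
proof -
  have fS: "finite S" using assms finite_subset by auto
  have "bij_betw (\<lambda>T. T \<union> S) {T. T \<subseteq> V - S \<and> card T = k - card S}
          {C. C \<subseteq> V \<and> card C = k \<and> S \<subseteq> C}"
  proof (rule bij_betw_byWitness[where f' = "\<lambda>C. C - S"], safe)
    fix T assume T: "T \<subseteq> V - S" "card T = k - card S"
    have "card (T \<union> S) = card T + card S"
      using T(1) fS assms(1) by (intro card_Un_disjoint) (auto intro: finite_subset)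
    then show "card (T \<union> S) = k" using T(2) assms(3) by simp
  next
    fix C assume "S \<subseteq> C"
    then show "card (C - S) = card C - card S"
      using card_Diff_subset[OF fS] by simp
  qed (use assms in auto)
  then have "card {C. C \<subseteq> V \<and> card C = k \<and> S \<subseteq> C}
      = card {T. T \<subseteq> V - S \<and> card T = k - card S}"
    by (simp add: bij_betw_same_card)
  also have "\<dots> = (card V - card S) choose (k - card S)"
    using n_subsets[of "V - S"] assms card_Diff_subset[OF fS assms(2)] by simp
  finally show ?thesis .
qed

lemma sum_power_card_Pow:
  fixes w :: real
  assumes "finite A"
  shows "(\<Sum>S\<in>Pow A. w ^ card S) = (1 + w) ^ card A"
  using prod_add[OF assms, of "\<lambda>_. w" "\<lambda>_. 1"] by (simp add: add.commute)

text \<open>Expanding \<open>z ^ h = (1 + (z - 1)) ^ h\<close> over the subsets \<open>S\<close> of \<open>C \<inter> D\<close> turns the sum over \<open>C\<close> into a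
  nonnegative combination of the numbers of \<open>k\<close>-sets containing \<open>S\<close>. With \<open>binomial_shift_le\<close> these behave
  as if the points of \<open>D\<close> were selected independently with probability \<open>k / n\<close>; resumming gives the
  binomial generating function.\<close>

lemma overlap_generating_function_le:
  fixes z :: real
  assumes V: "finite V" and D: "D \<subseteq> V" "card D = k" and z: "1 \<le> z"
  shows "(\<Sum>C | C \<subseteq> V \<and> card C = k. z ^ card (C \<inter> D))
    \<le> real (card V choose k) * exp ((real k)\<^sup>2 / real (card V) * (z - 1))"
proof -
  let ?n = "card V" and ?K = "{C. C \<subseteq> V \<and> card C = k}"
  have fD: "finite D" using V D finite_subset by auto
  have fK: "finite ?K" using V by simp
  have kn: "k \<le> ?n" using V D card_mono by auto
  have "(\<Sum>C\<in>?K. z ^ card (C \<inter> D)) = (\<Sum>C\<in>?K. \<Sum>S\<in>Pow (C \<inter> D). (z - 1) ^ card S)"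
    using fD by (subst sum_power_card_Pow) auto
  also have "\<dots> = (\<Sum>C\<in>?K. \<Sum>S\<in>{S \<in> Pow D. S \<subseteq> C}. (z - 1) ^ card S)"
    by (intro sum.cong) auto
  also have "\<dots> = (\<Sum>S\<in>Pow D. \<Sum>C\<in>{C \<in> ?K. S \<subseteq> C}. (z - 1) ^ card S)"
    using fK fD by (intro sum.swap_restrict) auto
  also have "\<dots> = (\<Sum>S\<in>Pow D. real ((?n - card S) choose (k - card S)) * (z - 1) ^ card S)"
  proof (rule sum.cong)
    fix S assume S: "S \<in> Pow D"
    have "card S \<le> k" using S D fD card_mono by auto
    moreover have "{C \<in> ?K. S \<subseteq> C} = {C. C \<subseteq> V \<and> card C = k \<and> S \<subseteq> C}" by auto
    ultimately show "(\<Sum>C\<in>{C \<in> ?K. S \<subseteq> C}. (z - 1) ^ card S)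
        = real ((?n - card S) choose (k - card S)) * (z - 1) ^ card S"
      using card_supersets[OF V, of S k] S D by auto
  qed simp
  also have "\<dots> \<le> (\<Sum>S\<in>Pow D. real (?n choose k) * (real k / real ?n * (z - 1)) ^ card S)"
  proof (rule sum_mono)
    fix S assume S: "S \<in> Pow D"
    have "card S \<le> k" using S D fD card_mono by auto
    from binomial_shift_le[OF this kn]
    have "real ((?n - card S) choose (k - card S)) * (z - 1) ^ card S
        \<le> real (?n choose k) * (real k / real ?n) ^ card S * (z - 1) ^ card S"
      using z by (intro mult_right_mono) auto
    then show "real ((?n - card S) choose (k - card S)) * (z - 1) ^ card S
        \<le> real (?n choose k) * (real k / real ?n * (z - 1)) ^ card S"
      by (simp only: power_mult_distrib mult.assoc)
  qed
  also have "\<dots> = real (?n choose k) * (1 + real k / real ?n * (z - 1)) ^ k"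
    using sum_power_card_Pow[OF fD, of "real k / real ?n * (z - 1)"] D
    by (simp add: sum_distrib_left[symmetric])
  also have "\<dots> \<le> real (?n choose k) * exp (real k / real ?n * (z - 1)) ^ k"
    using z by (intro mult_left_mono power_mono exp_ge_add_one_self) auto
  also have "exp (real k / real ?n * (z - 1)) ^ k = exp ((real k)\<^sup>2 / real ?n * (z - 1))"
    by (simp add: exp_of_nat_mult[symmetric] power2_eq_square)
  finally show ?thesis .
qed

section \<open>Second moment method for mixtures of conditional laws\<close>

text \<open>The right-hand side is the probability of \<open>B\<close> under the uniform mixture of the conditional laws given
  \<open>A i\<close>. That mixture has density \<open>L\<close> with mean \<open>1\<close>, the double sum is \<open>(card I)\<^sup>2\<close> times the second moment
  of \<open>L\<close>, and Cauchy-Schwarz bounds the mean of \<open>1 - L\<close> over \<open>B\<close> by the standard deviation of \<open>L\<close>.\<close>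

lemma (in prob_space) mixture_of_conditionals_lower_bound:
  assumes I: "finite I" "I \<noteq> {}"
    and A: "\<And>i. i \<in> I \<Longrightarrow> A i \<in> events" "\<And>i. i \<in> I \<Longrightarrow> 0 < prob (A i)"
    and B: "B \<in> events"
    and moment: "(\<Sum>i\<in>I. \<Sum>j\<in>I. prob (A i \<inter> A j) / (prob (A i) * prob (A j)))
      \<le> (real (card I))\<^sup>2 * (1 + d)"
  shows "prob B - sqrt d \<le> (\<Sum>i\<in>I. prob (A i \<inter> B) / prob (A i)) / real (card I)"
proof -
  define N where "N = real (card I)"
  have N: "0 < N" using I by (simp add: N_def card_gt_0_iff)
  define L where "L x = (\<Sum>i\<in>I. indicator (A i) x / prob (A i)) / N" for x
  have int: "integrable M (\<lambda>x. indicator E x :: real)" if "E \<in> events" for E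
    using that by (simp add: less_top[symmetric])
  have int_c: "integrable M (\<lambda>x. c * indicator E x :: real)" if "E \<in> events" for E c
    using int[OF that] by simp
  have int_d: "integrable M (\<lambda>x. indicator E x / c :: real)" if "E \<in> events" for E c
    using int[OF that] by simp
  have E_ind: "expectation (\<lambda>x. indicator E x :: real) = prob E" if "E \<in> events" for E
    using that by simp
  have L_eq: "L x = (\<Sum>i\<in>I. (1 / (N * prob (A i))) * indicator (A i) x)" for x
    unfolding L_def by (simp add: sum_divide_distrib mult.commute)
  have BL_eq: "indicator B x * L x = (\<Sum>i\<in>I. (1 / (N * prob (A i))) * indicator (A i \<inter> B) x)" for x
    unfolding L_eq by (simp add: sum_distrib_left indicator_inter_arith mult_ac)
  have LL_eq: "(L x)\<^sup>2 = (\<Sum>i\<in>I. \<Sum>j\<in>I.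
      (1 / (N * prob (A i)) * (1 / (N * prob (A j)))) * indicator (A i \<inter> A j) x)" for x
    unfolding L_eq power2_eq_square sum_product by (simp add: indicator_inter_arith mult_ac)
  have iL: "integrable M L" unfolding L_eq[abs_def] using A by (intro Bochner_Integration.integrable_sum int_c) auto
  have iBL: "integrable M (\<lambda>x. indicator B x * L x)"
    unfolding BL_eq[abs_def] using A B by (intro Bochner_Integration.integrable_sum int_c) auto
  have iLL: "integrable M (\<lambda>x. (L x)\<^sup>2)"
    unfolding LL_eq[abs_def] using A by (intro Bochner_Integration.integrable_sum int_c) auto
  have EL: "expectation L = 1"
  proof -
    have "expectation L = (\<Sum>i\<in>I. (1 / (N * prob (A i))) * prob (A i))"
      unfolding L_eq[abs_def] using A
      by (subst Bochner_Integration.integral_sum) (auto intro!: int_c int_d sum.cong simp: E_ind)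
    also have "\<dots> = (\<Sum>i\<in>I. 1 / N)" using A N by (intro sum.cong) (force simp: field_simps)+
    finally show ?thesis using N by (simp add: N_def)
  qed
  have EBL: "expectation (\<lambda>x. indicator B x * L x) = (\<Sum>i\<in>I. prob (A i \<inter> B) / prob (A i)) / N"
  proof -
    have "expectation (\<lambda>x. indicator B x * L x) = (\<Sum>i\<in>I. (1 / (N * prob (A i))) * prob (A i \<inter> B))"
      unfolding BL_eq[abs_def] using A B
      by (subst Bochner_Integration.integral_sum) (auto intro!: int_c int_d sum.cong simp: E_ind)
    then show ?thesis by (simp add: sum_divide_distrib mult.commute)
  qed
  have ELL: "expectation (\<lambda>x. (L x)\<^sup>2) \<le> 1 + d"
  proof -
    have "expectation (\<lambda>x. (L x)\<^sup>2) = (\<Sum>i\<in>I. \<Sum>j\<in>I.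
        (1 / (N * prob (A i)) * (1 / (N * prob (A j)))) * prob (A i \<inter> A j))"
      unfolding LL_eq[abs_def] using A
      by (subst Bochner_Integration.integral_sum, intro Bochner_Integration.integrable_sum int_c, simp,
          intro sum.cong refl, subst Bochner_Integration.integral_sum)
         (auto intro!: int_c int_d sum.cong simp: E_ind)
    also have "\<dots> = (\<Sum>i\<in>I. \<Sum>j\<in>I. prob (A i \<inter> A j) / (prob (A i) * prob (A j))) / N\<^sup>2"
      by (simp add: sum_divide_distrib power2_eq_square mult_ac)
    also have "\<dots> \<le> 1 + d"
      using moment N by (simp add: N_def[symmetric] field_simps)
    finally show ?thesis .
  qed
  let ?f = "\<lambda>x. indicator B x * (1 - L x)"
  have f_eq: "?f = (\<lambda>x. indicator B x - indicator B x * L x)" by (simp add: algebra_simps)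
  have if1: "integrable M ?f" unfolding f_eq by (intro Bochner_Integration.integrable_diff iBL int B)
  have sq: "(?f x)\<^sup>2 = indicator B x - 2 * (indicator B x * L x) + indicator B x * (L x)\<^sup>2" for x
    by (simp add: power2_eq_square algebra_simps split: split_indicator)
  have iBLL: "integrable M (\<lambda>x. indicator B x * (L x)\<^sup>2)"
    using integrable_mult_indicator[OF B iLL] by simp
  have if2: "integrable M (\<lambda>x. (?f x)\<^sup>2)" unfolding sq
    by (intro Bochner_Integration.integrable_add Bochner_Integration.integrable_diff
        integrable_mult_right iBL iBLL int B)
  have i1L: "integrable M (\<lambda>x. (1 - L x)\<^sup>2)"
    using iL iLL by (simp add: power2_diff)
  \<comment> \<open>Cauchy-Schwarz in the form that the variance of \<open>?f\<close> is nonnegative.\<close>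
  have "(expectation ?f)\<^sup>2 \<le> expectation (\<lambda>x. (?f x)\<^sup>2)"
    using variance_positive[of ?f] variance_eq[OF if1 if2] by simp
  also have "\<dots> \<le> expectation (\<lambda>x. (1 - L x)\<^sup>2)"
    using if2 i1L by (intro integral_mono) (auto split: split_indicator)
  also have "\<dots> = 1 - 2 * expectation L + expectation (\<lambda>x. (L x)\<^sup>2)"
    using iL iLL by (simp add: power2_diff prob_space)
  also have "\<dots> \<le> d" using EL ELL by simp
  finally have "expectation ?f \<le> sqrt d" by (rule real_le_rsqrt)
  moreover have "expectation ?f = prob B - expectation (\<lambda>x. indicator B x * L x)"
    unfolding f_eq using iBL int[OF B] B by (subst Bochner_Integration.integral_diff) auto
  ultimately show ?thesis using EBL by (simp add: N_def)
qed

section \<open>The planted law as a conditional law\<close>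

text \<open>Conditioning independent coordinates on a box conditions each coordinate separately.\<close>

lemma PiM_uniform_measure:
  assumes I: "finite I" and M: "\<And>i. prob_space (M i)"
    and S: "\<And>i. S i \<in> sets (M i)" "\<And>i. 0 < measure (M i) (S i)"
  shows "PiM I (\<lambda>i. uniform_measure (M i) (S i)) = uniform_measure (PiM I M) (Pi\<^sub>E I S)"
proof -
  interpret M: product_prob_space M I
    by (rule product_prob_spaceI) (rule M)
  interpret U: product_prob_space "\<lambda>i. uniform_measure (M i) (S i)" I
  proof (rule product_prob_spaceI, rule prob_space_uniform_measure)
    show "emeasure (M i) (S i) \<noteq> 0" for i
      using S(2)[of i] by (auto simp: measure_def)
    show "emeasure (M i) (S i) \<noteq> \<infinity>" for i
      using M[of i] by (simp add: prob_space.finite_measure finite_measure.emeasure_finite)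
  qed
  have em: "emeasure (M i) X = ennreal (measure (M i) X)" for i X
    using M[of i] by (simp add: prob_space.finite_measure finite_measure.emeasure_eq_measure)
  have box: "Pi\<^sub>E I X \<in> sets (PiM I M)" if "\<And>i. i \<in> I \<Longrightarrow> X i \<in> sets (M i)" for X
    using that I by (intro sets_PiM_I_finite) auto
  have "uniform_measure (PiM I M) (Pi\<^sub>E I S) = PiM I (\<lambda>i. uniform_measure (M i) (S i))"
  proof (rule U.PiM_eqI[OF I])
    show "sets (uniform_measure (PiM I M) (Pi\<^sub>E I S)) = sets (PiM I (\<lambda>i. uniform_measure (M i) (S i)))"
      by (simp cong: sets_PiM_cong)
    fix X assume "\<And>i. i \<in> I \<Longrightarrow> X i \<in> sets (uniform_measure (M i) (S i))"
    then have X: "\<And>i. i \<in> I \<Longrightarrow> X i \<in> sets (M i)" by simp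
    have "emeasure (uniform_measure (PiM I M) (Pi\<^sub>E I S)) (Pi\<^sub>E I X)
        = emeasure (PiM I M) (\<Pi>\<^sub>E i\<in>I. S i \<inter> X i) / emeasure (PiM I M) (Pi\<^sub>E I S)"
      using X S by (simp add: box PiE_Int)
    also have "\<dots> = ennreal (\<Prod>i\<in>I. measure (M i) (S i \<inter> X i)) / ennreal (\<Prod>i\<in>I. measure (M i) (S i))"
      using X S I by (simp add: M.emeasure_PiM em prod_ennreal)
    also have "\<dots> = ennreal (\<Prod>i\<in>I. measure (M i) (S i \<inter> X i) / measure (M i) (S i))"
      using S by (subst divide_ennreal) (auto intro!: prod_nonneg prod_pos simp: prod_dividef)
    also have "\<dots> = (\<Prod>i\<in>I. ennreal (measure (M i) (S i \<inter> X i) / measure (M i) (S i)))"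
      by (subst prod_ennreal) auto
    also have "\<dots> = (\<Prod>i\<in>I. emeasure (uniform_measure (M i) (S i)) (X i))"
      using X S by (intro prod.cong) (simp_all add: em divide_ennreal)
    finally show "emeasure (uniform_measure (PiM I M) (Pi\<^sub>E I S)) (Pi\<^sub>E I X)
        = (\<Prod>i\<in>I. emeasure (uniform_measure (M i) (S i)) (X i))" .
  qed
  then show ?thesis by simp
qed

text \<open>Defined as a box over all edges, with the whole circle as the side for edges outside \<open>F\<close>, so that
  \<open>PiM_uniform_measure\<close> applies directly.\<close>

definition arc_event :: "nat \<Rightarrow> real \<Rightarrow> real \<Rightarrow> nat set set \<Rightarrow> (nat set \<Rightarrow> real) set" where
  "arc_event n \<theta> \<tau> F = (\<Pi>\<^sub>E e\<in>edges {1..n}. if e \<in> F then angle_arc \<theta> \<tau> else {0..<2 * pi})"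

lemma arc_event_Int: "arc_event n \<theta> \<tau> F \<inter> arc_event n \<theta> \<tau> G = arc_event n \<theta> \<tau> (F \<union> G)"
  using angle_arc_subset[of \<theta> \<tau>] unfolding arc_event_def PiE_Int
  by (intro PiE_cong) auto

lemma angle_arc_in_sets: "angle_arc \<theta> \<tau> \<in> sets angle_space"
  using sets_angle_arc angle_arc_subset by (simp add: sets_angle_space)

lemma circle_in_sets: "{0..<2 * pi} \<in> sets angle_space"
  by (simp add: sets_angle_space)

lemma measure_uniform_angle_circle: "measure uniform_angle {0..<2 * pi} = 1"
  using prob_space.prob_space[OF prob_space_uniform_angle]
  by (simp add: uniform_angle_def space_angle_space)

lemma measure_uniform_angle_arc:
  assumes "\<theta> \<in> {0..<2 * pi}" "0 < \<tau>" "\<tau> < 1"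
  shows "measure uniform_angle (angle_arc \<theta> \<tau>) = \<tau>"
proof -
  have "emeasure uniform_angle (angle_arc \<theta> \<tau>) = ennreal (2 * pi * \<tau>) / ennreal (2 * pi)"
    using emeasure_angle_arc[OF assms] angle_arc_subset[of \<theta> \<tau>] angle_arc_in_sets circle_in_sets
    by (simp add: uniform_angle_def Int_absorb1 emeasure_angle_space)
  also have "\<dots> = ennreal \<tau>" using assms by (subst divide_ennreal) auto
  finally show ?thesis using assms by (simp add: measure_def)
qed

lemma sets_null_law: "sets (null_law n) = sets (data_space n)"
  unfolding null_law_def data_space_def by (rule sets_PiM_cong) (auto simp: sets_uniform_angle)

lemma prob_space_null_law: "prob_space (null_law n)"
  unfolding null_law_def by (rule prob_space_PiM) (rule prob_space_uniform_angle)

lemma arc_event_in_sets: "arc_event n \<theta> \<tau> F \<in> sets (null_law n)"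
  unfolding arc_event_def null_law_def
  using angle_arc_in_sets circle_in_sets
  by (intro sets_PiM_I_finite) (auto simp: finite_edges sets_uniform_angle)

lemma measure_arc_event:
  assumes "\<theta> \<in> {0..<2 * pi}" "0 < \<tau>" "\<tau> < 1" "F \<subseteq> edges {1..n}"
  shows "measure (null_law n) (arc_event n \<theta> \<tau> F) = \<tau> ^ card F"
proof -
  interpret product_prob_space "\<lambda>_. uniform_angle" "edges {1..n}"
    by (rule product_prob_spaceI) (rule prob_space_uniform_angle)
  have "emeasure (null_law n) (arc_event n \<theta> \<tau> F)
      = (\<Prod>e\<in>edges {1..n}. emeasure uniform_angle (if e \<in> F then angle_arc \<theta> \<tau> else {0..<2 * pi}))"
    unfolding null_law_def arc_event_def
    using angle_arc_in_sets circle_in_sets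
    by (intro emeasure_PiM) (auto simp: finite_edges sets_uniform_angle)
  also have "\<dots> = (\<Prod>e\<in>edges {1..n}. if e \<in> F then ennreal \<tau> else 1)"
    using measure_uniform_angle_arc[OF assms(1-3)] measure_uniform_angle_circle prob_space_uniform_angle
    by (intro prod.cong) (simp_all add: prob_space.finite_measure finite_measure.emeasure_eq_measure)
  also have "\<dots> = ennreal (\<tau> ^ card F)"
    using assms(2,4) by (simp add: prod.If_cases finite_edges Int_absorb1 ennreal_power)
  finally show ?thesis using assms(2) by (simp add: measure_def)
qed

lemma uniform_arc_eq_conditional:
  assumes "\<theta> \<in> {0..<2 * pi}" "0 < \<tau>" "\<tau> < 1"
  shows "uniform_arc \<theta> \<tau> = uniform_measure uniform_angle (angle_arc \<theta> \<tau>)"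
proof (rule measure_eqI)
  fix X assume "X \<in> sets (uniform_arc \<theta> \<tau>)"
  then have X: "X \<in> sets angle_space" by (simp add: sets_uniform_arc)
  have XA: "angle_arc \<theta> \<tau> \<inter> X \<in> sets angle_space" using X angle_arc_in_sets by auto
  have circ: "{0..<2 * pi} \<inter> (angle_arc \<theta> \<tau> \<inter> X) = angle_arc \<theta> \<tau> \<inter> X"
    "{0..<2 * pi} \<inter> angle_arc \<theta> \<tau> = angle_arc \<theta> \<tau>"
    using angle_arc_subset[of \<theta> \<tau>] by auto
  have "emeasure (uniform_measure uniform_angle (angle_arc \<theta> \<tau>)) X
     = (emeasure angle_space (angle_arc \<theta> \<tau> \<inter> X) / ennreal (2 * pi)) / ennreal \<tau>"
  proof -
    have "emeasure uniform_angle (angle_arc \<theta> \<tau>) = ennreal \<tau>"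
      using measure_uniform_angle_arc[OF assms] prob_space_uniform_angle
      by (simp add: prob_space.finite_measure finite_measure.emeasure_eq_measure)
    moreover have "emeasure uniform_angle (angle_arc \<theta> \<tau> \<inter> X)
        = emeasure angle_space (angle_arc \<theta> \<tau> \<inter> X) / ennreal (2 * pi)"
      unfolding uniform_angle_def using XA circle_in_sets circ
      by (simp add: emeasure_angle_space)
    ultimately show ?thesis
      using X angle_arc_in_sets by (simp add: sets_uniform_angle)
  qed
  also have "\<dots> = emeasure angle_space (angle_arc \<theta> \<tau> \<inter> X) / ennreal (2 * pi * \<tau>)"
  proof -
    have "emeasure angle_space (angle_arc \<theta> \<tau> \<inter> X) \<le> ennreal (2 * pi * \<tau>)"
      using emeasure_mono[OF _ angle_arc_in_sets, of "angle_arc \<theta> \<tau> \<inter> X" \<theta> \<tau>]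
      by (simp add: emeasure_angle_arc[OF assms])
    then obtain r where "0 \<le> r" "emeasure angle_space (angle_arc \<theta> \<tau> \<inter> X) = ennreal r"
      by (cases "emeasure angle_space (angle_arc \<theta> \<tau> \<inter> X)") (auto simp: top_unique)
    then show ?thesis using assms by (simp add: divide_ennreal)
  qed
  also have "\<dots> = emeasure (uniform_arc \<theta> \<tau>) X"
    using X angle_arc_in_sets by (simp add: uniform_arc_def emeasure_angle_arc[OF assms])
  finally show "emeasure (uniform_arc \<theta> \<tau>) X = emeasure (uniform_measure uniform_angle (angle_arc \<theta> \<tau>)) X" ..
qed (simp add: sets_uniform_arc sets_uniform_angle)

lemma uniform_angle_eq_conditional: "uniform_angle = uniform_measure uniform_angle {0..<2 * pi}"
proof (rule measure_eqI)
  fix X assume X: "X \<in> sets uniform_angle"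
  have "emeasure uniform_angle {0..<2 * pi} = 1"
    using measure_uniform_angle_circle prob_space_uniform_angle
    by (simp add: prob_space.finite_measure finite_measure.emeasure_eq_measure)
  moreover have "{0..<2 * pi} \<inter> X = X"
    using X by (auto simp: sets_uniform_angle sets_angle_space)
  ultimately show "emeasure uniform_angle X = emeasure (uniform_measure uniform_angle {0..<2 * pi}) X"
    using X circle_in_sets by (simp add: sets_uniform_angle divide_ennreal_def)
qed simp

text \<open>Both kinds of coordinate law are conditionings of the uniform law on the circle, on the arc or, trivially,
  on the whole circle.\<close>

lemma planted_law_given_eq_conditional:
  assumes "\<theta> \<in> {0..<2 * pi}" "0 < \<tau>" "\<tau> < 1"
  shows "planted_law_given n \<tau> C \<theta> = uniform_measure (null_law n) (arc_event n \<theta> \<tau> (edges C))"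
proof -
  have "planted_law_given n \<tau> C \<theta>
      = PiM (edges {1..n}) (\<lambda>e. uniform_measure uniform_angle
          (if e \<in> edges C then angle_arc \<theta> \<tau> else {0..<2 * pi}))"
    unfolding planted_law_given_def
    by (intro PiM_cong) (simp_all add: uniform_arc_eq_conditional[OF assms] flip: uniform_angle_eq_conditional)
  also have "\<dots> = uniform_measure (null_law n) (arc_event n \<theta> \<tau> (edges C))"
    unfolding null_law_def arc_event_def
    using angle_arc_in_sets circle_in_sets assms
    by (intro PiM_uniform_measure)
       (auto simp: finite_edges prob_space_uniform_angle sets_uniform_angle
          measure_uniform_angle_arc measure_uniform_angle_circle)
  finally show ?thesis .
qed

section \<open>Lower bound on the sum of the error probabilities\<close>

lemma edges_Int: "edges C \<inter> edges D = edges (C \<inter> D)"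
  by (auto simp: edges_def)

lemma card_edges: "finite C \<Longrightarrow> card (edges C) = card C choose 2"
  unfolding edges_def by (rule n_subsets)

text \<open>Here \<open>C\<close> stands for the intersection of two communities. The exponent \<open>h (h - 1) / 2\<close> is linearised by
  \<open>h - 1 \<le> k - 1\<close>, an equality when the two communities coincide.\<close>

lemma overlap_weight_le:
  assumes \<tau>: "0 < \<tau>" "\<tau> < 1" and C: "finite C" "card C \<le> k" "1 \<le> k"
  shows "(1 / \<tau>) ^ card (edges C) \<le> (\<tau> powr (- (real k - 1) / 2)) ^ card C"
proof -
  let ?h = "card C"
  have "(1 / \<tau>) ^ card (edges C) = \<tau> powr (- real (?h choose 2))"
    using \<tau> C(1) by (simp add: card_edges powr_minus powr_realpow power_one_over inverse_eq_divide)
  also have "\<dots> \<le> \<tau> powr (- (real k - 1) / 2 * real ?h)"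
  proof (rule powr_mono')
    have "real (?h choose 2) = real ?h * (real ?h - 1) / 2"
      by (cases ?h) (simp_all add: choose_two real_of_nat_div algebra_simps)
    also have "\<dots> \<le> real ?h * (real k - 1) / 2"
      using C by (intro divide_right_mono mult_left_mono) auto
    finally show "- (real k - 1) / 2 * real ?h \<le> - real (?h choose 2)"
      by (simp add: field_simps)
  qed (use \<tau> in auto)
  also have "\<dots> = (\<tau> powr (- (real k - 1) / 2)) ^ ?h"
    using \<tau> by (simp add: powr_powr flip: powr_realpow)
  finally show ?thesis .
qed

text \<open>One plus the \<open>\<chi>\<^sup>2\<close>-divergence of the planted law, at any fixed phase, from the null law is at most the
  exponential of this quantity.\<close>

definition chi_square_exponent :: "nat \<Rightarrow> nat \<Rightarrow> real \<Rightarrow> real" where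
  "chi_square_exponent n k \<tau> = (real k)\<^sup>2 / real n * (\<tau> powr (- (real k - 1) / 2) - 1)"

lemma fixed_phase_lower_bound:
  assumes \<tau>: "0 < \<tau>" "\<tau> < 1" and k: "1 \<le> k" "k \<le> n"
    and \<theta>: "\<theta> \<in> {0..<2 * pi}" and B: "B \<in> sets (data_space n)"
  shows "measure (null_law n) B - sqrt (exp (chi_square_exponent n k \<tau>) - 1)
    \<le> (\<Sum>C | C \<subseteq> {1..n} \<and> card C = k. measure (planted_law_given n \<tau> C \<theta>) B) / real (n choose k)"
proof -
  interpret Q: prob_space "null_law n" by (rule prob_space_null_law)
  let ?K = "{C. C \<subseteq> {1..n} \<and> card C = k}"
  let ?A = "\<lambda>C. arc_event n \<theta> \<tau> (edges C)"
  let ?z = "\<tau> powr (- (real k - 1) / 2)"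
  have fin: "finite ?K" by simp
  have cardK: "card ?K = n choose k" using n_subsets[of "{1..n}" k] by simp
  have ne: "?K \<noteq> {}" using cardK k by (metis card.empty binomial_eq_0_iff not_le)
  have z: "1 \<le> ?z"
    using \<tau> k powr_mono'[of "- (real k - 1) / 2" 0 \<tau>] by simp
  have sub: "edges C \<subseteq> edges {1..n}" if "C \<in> ?K" for C
    using that by (auto simp: edges_def)
  have prob_A: "Q.prob (?A C) = \<tau> ^ card (edges C)" if "C \<in> ?K" for C
    using measure_arc_event[OF \<theta> \<tau> sub[OF that]] .
  have ratio: "Q.prob (?A C \<inter> ?A D) / (Q.prob (?A C) * Q.prob (?A D)) \<le> ?z ^ card (C \<inter> D)"
    if C: "C \<in> ?K" and D: "D \<in> ?K" for C D
  proof -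
    have fC: "finite C" "finite D" using C D by (auto intro: finite_subset)
    have "card (edges C) + card (edges D) = card (edges C \<union> edges D) + card (edges (C \<inter> D))"
      using fC by (subst card_Un_Int) (auto simp: finite_edges edges_Int)
    then have "\<tau> ^ card (edges C) * \<tau> ^ card (edges D)
        = \<tau> ^ card (edges C \<union> edges D) * \<tau> ^ card (edges (C \<inter> D))"
      by (simp flip: power_add)
    moreover have "Q.prob (?A C \<inter> ?A D) = \<tau> ^ card (edges C \<union> edges D)"
      unfolding arc_event_Int using sub C D by (intro measure_arc_event \<theta> \<tau>) auto
    ultimately have "Q.prob (?A C \<inter> ?A D) / (Q.prob (?A C) * Q.prob (?A D)) = (1 / \<tau>) ^ card (edges (C \<inter> D))"
      using \<tau> by (simp add: prob_A[OF C] prob_A[OF D] power_one_over)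
    also have "\<dots> \<le> ?z ^ card (C \<inter> D)"
      using fC C k card_mono[of C "C \<inter> D"] by (intro overlap_weight_le \<tau>) auto
    finally show ?thesis .
  qed
  \<comment> \<open>The overlap bound holds for each fixed \<open>D\<close>, so only \<open>C\<close> needs to be averaged.\<close>
  have "(\<Sum>D\<in>?K. \<Sum>C\<in>?K. Q.prob (?A D \<inter> ?A C) / (Q.prob (?A D) * Q.prob (?A C)))
      \<le> (\<Sum>D\<in>?K. real (n choose k) * exp (chi_square_exponent n k \<tau>))"
  proof (rule sum_mono)
    fix D assume D: "D \<in> ?K"
    have "(\<Sum>C\<in>?K. Q.prob (?A D \<inter> ?A C) / (Q.prob (?A D) * Q.prob (?A C)))
        \<le> (\<Sum>C\<in>?K. ?z ^ card (C \<inter> D))"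
      using ratio[OF D] by (intro sum_mono) (simp add: Int_commute)
    also have "\<dots> \<le> real (n choose k) * exp (chi_square_exponent n k \<tau>)"
      using overlap_generating_function_le[of "{1..n}" D k ?z] D z
      by (simp add: chi_square_exponent_def)
    finally show "(\<Sum>C\<in>?K. Q.prob (?A D \<inter> ?A C) / (Q.prob (?A D) * Q.prob (?A C)))
        \<le> real (n choose k) * exp (chi_square_exponent n k \<tau>)" .
  qed
  also have "\<dots> = (real (card ?K))\<^sup>2 * (1 + (exp (chi_square_exponent n k \<tau>) - 1))"
    by (simp add: cardK power2_eq_square del: One_nat_def)
  finally have "Q.prob B - sqrt (exp (chi_square_exponent n k \<tau>) - 1)
      \<le> (\<Sum>C\<in>?K. Q.prob (?A C \<inter> B) / Q.prob (?A C)) / real (card ?K)"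
    using fin ne B \<tau> prob_A arc_event_in_sets
    by (intro Q.mixture_of_conditionals_lower_bound) (auto simp: sets_null_law)
  also have "(\<Sum>C\<in>?K. Q.prob (?A C \<inter> B) / Q.prob (?A C))
      = (\<Sum>C\<in>?K. measure (planted_law_given n \<tau> C \<theta>) B)"
  proof (rule sum.cong)
    fix C assume C: "C \<in> ?K"
    have "0 < Q.prob (?A C)" using prob_A[OF C] \<tau> by simp
    then have "emeasure (null_law n) (?A C) \<noteq> 0" by (auto simp: measure_def)
    then show "Q.prob (?A C \<inter> B) / Q.prob (?A C) = measure (planted_law_given n \<tau> C \<theta>) B"
      using B by (simp add: planted_law_given_eq_conditional[OF \<theta> \<tau>] sets_null_law)
  qed simp
  finally show ?thesis unfolding cardK .
qed

text \<open>The bound at a fixed phase does not depend on the phase, so it can be integrated.\<close>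

lemma planted_law_lower_bound:
  assumes \<tau>: "0 < \<tau>" "\<tau> < 1" and k: "1 \<le> k" "k \<le> n" and B: "B \<in> sets (data_space n)"
  shows "measure (null_law n) B - sqrt (exp (chi_square_exponent n k \<tau>) - 1)
    \<le> measure (planted_law n k \<tau>) B"
proof -
  interpret P: prob_space "planted_law n k \<tau>" by (rule prob_space_planted_law[OF \<tau>])
  interpret U: prob_space uniform_angle by (rule prob_space_uniform_angle)
  let ?K = "{C. C \<subseteq> {1..n} \<and> card C = k}"
  let ?b = "measure (null_law n) B - sqrt (exp (chi_square_exponent n k \<tau>) - 1)"
  let ?P = "\<lambda>C \<theta>. emeasure (planted_law_given n \<tau> C \<theta>) B"
  have fin: "finite ?K" by simp
  have cardK: "card ?K = n choose k" using n_subsets[of "{1..n}" k] by simp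
  have ne: "?K \<noteq> {}" using cardK k by (metis card.empty binomial_eq_0_iff not_le)
  have meas: "?P C \<in> borel_measurable uniform_angle" for C
    using measurable_compose[OF measurable_prob_algebraD[OF planted_law_given_kernel[OF \<tau>]]
        measurable_emeasure_subprob_algebra[OF B]] .
  have pos: "0 < n choose k" using k by simp
  have "ennreal ?b = (\<integral>\<^sup>+\<theta>. ennreal ?b \<partial>uniform_angle)"
    by (simp add: U.emeasure_space_1)
  also have "\<dots> \<le> (\<integral>\<^sup>+\<theta>. (\<Sum>C\<in>?K. ?P C \<theta>) / ennreal (real (n choose k)) \<partial>uniform_angle)"
  proof (rule nn_integral_mono)
    fix \<theta> assume "\<theta> \<in> space uniform_angle"
    then have \<theta>: "\<theta> \<in> {0..<2 * pi}" by (simp add: uniform_angle_def space_angle_space)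
    have "prob_space (planted_law_given n \<tau> C \<theta>)" for C
      unfolding planted_law_given_def
      by (rule prob_space_PiM) (simp add: prob_space_uniform_angle prob_space_uniform_arc[OF \<theta> \<tau>])
    then have "?P C \<theta> = ennreal (measure (planted_law_given n \<tau> C \<theta>) B)" for C
      by (simp add: prob_space.finite_measure finite_measure.emeasure_eq_measure)
    then have "(\<Sum>C\<in>?K. ?P C \<theta>) / ennreal (real (n choose k))
        = ennreal ((\<Sum>C\<in>?K. measure (planted_law_given n \<tau> C \<theta>) B) / real (n choose k))"
      using pos by (simp add: sum_nonneg divide_ennreal)
    then show "ennreal ?b \<le> (\<Sum>C\<in>?K. ?P C \<theta>) / ennreal (real (n choose k))"
      using fixed_phase_lower_bound[OF \<tau> k \<theta> B] by (simp add: ennreal_leI)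
  qed
  also have "\<dots> = (\<Sum>C\<in>?K. \<integral>\<^sup>+\<theta>. ?P C \<theta> \<partial>uniform_angle) / ennreal (real (n choose k))"
    using meas by (simp add: nn_integral_divide nn_integral_sum)
  also have "\<dots> = emeasure (planted_law n k \<tau>) B"
    unfolding emeasure_planted_law[OF \<tau> B] community_law_def
    using ne
    by (simp add: nn_integral_pmf_of_set cardK ennreal_of_nat_eq_real_of_nat del: One_nat_def)
  finally show ?thesis by (simp add: P.emeasure_eq_measure)
qed

lemma error_sum_lower_bound:
  assumes "0 < \<tau>" "\<tau> < 1" "1 \<le> k" "k \<le> n" "is_test n \<phi>"
  shows "1 - sqrt (exp (chi_square_exponent n k \<tau>) - 1) \<le> p_fa n \<phi> + p_miss n k \<tau> \<phi>"
proof -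
  interpret Q: prob_space "null_law n" by (rule prob_space_null_law)
  have [measurable]: "Measurable.pred (data_space n) \<phi>" using assms by (simp add: is_test_def)
  let ?B = "{x \<in> space (data_space n). \<not> \<phi> x}"
  have B: "?B \<in> sets (data_space n)" by measurable
  have sp: "space (null_law n) = space (data_space n)"
    by (rule sets_eq_imp_space_eq) (rule sets_null_law)
  have "{x \<in> space (data_space n). \<phi> x} = space (null_law n) - ?B" by (auto simp: sp)
  then have "p_fa n \<phi> = 1 - measure (null_law n) ?B"
    using Q.prob_compl[of ?B] B by (simp add: p_fa_def sets_null_law)
  then show ?thesis
    using planted_law_lower_bound[OF assms(1-4) B] by (simp add: p_miss_def)
qed

lemma weak_detection_impossibleI:
  assumes "\<forall>\<^sub>F n in sequentially. 2 \<le> k n \<and> k n \<le> n"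
    and "\<forall>\<^sub>F n in sequentially. 0 < \<tau> n \<and> \<tau> n < 1"
    and lim: "(\<lambda>n. chi_square_exponent n (k n) (\<tau> n)) \<longlonglongrightarrow> 0"
  shows "weak_detection_impossible k \<tau>"
  unfolding weak_detection_impossible_def
proof (intro allI impI exI conjI)
  fix \<phi> :: "nat \<Rightarrow> (nat set \<Rightarrow> real) \<Rightarrow> bool"
  assume test: "\<forall>n. is_test n (\<phi> n)"
  have "(\<lambda>n. sqrt (exp (chi_square_exponent n (k n) (\<tau> n)) - 1)) \<longlonglongrightarrow> sqrt (exp 0 - 1)"
    by (intro tendsto_intros lim)
  then show "(\<lambda>n. sqrt (exp (chi_square_exponent n (k n) (\<tau> n)) - 1)) \<longlonglongrightarrow> 0" by simp
  show "\<forall>\<^sub>F n in sequentially. p_fa n (\<phi> n) + p_miss n (k n) (\<tau> n) (\<phi> n)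
      \<ge> 1 - sqrt (exp (chi_square_exponent n (k n) (\<tau> n)) - 1)"
    using assms(1,2)
    by eventually_elim (use test in \<open>auto intro!: error_sum_lower_bound\<close>)
qed

lemma chi_square_exponent_nonneg:
  assumes "0 < \<tau>" "\<tau> < 1" "1 \<le> k"
  shows "0 \<le> chi_square_exponent n k \<tau>"
  using assms powr_mono'[of "- (real k - 1) / 2" 0 \<tau>] by (simp add: chi_square_exponent_def)

section \<open>The three regimes\<close>

text \<open>With \<open>q = k\<^sup>2 / n\<close>, the bound on \<open>\<tau>\<close> is calibrated so that
  \<open>\<tau> powr (- (k - 1) / 2) \<le> q powr (- (1 - \<epsilon> / 2))\<close>. The product with \<open>q\<close> is then at most
  \<open>q powr (\<epsilon> / 2)\<close>, which vanishes because \<open>q\<close> does.\<close>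

lemma weak_detection_impossible_small_community:
  assumes k: "\<forall>\<^sub>F n in sequentially. 2 \<le> k n \<and> k n \<le> n"
    and \<tau>: "\<forall>\<^sub>F n in sequentially. 0 < \<tau> n \<and> \<tau> n < 1"
    and small: "(\<lambda>n. real (k n)) \<in> o(\<lambda>n. sqrt (real n))"
    and \<epsilon>: "0 < \<epsilon>"
    and bound: "\<forall>\<^sub>F n in sequentially.
      \<tau> n \<ge> exp (- ((2 - \<epsilon>) * ln (real n / (real (k n))\<^sup>2)) / (real (k n) - 1))"
  shows "weak_detection_impossible k \<tau>"
proof (rule weak_detection_impossibleI[OF k \<tau>])
  let ?q = "\<lambda>n. (real (k n))\<^sup>2 / real n"
  have "(\<lambda>n. (real (k n) / sqrt (real n))\<^sup>2) \<longlonglongrightarrow> 0\<^sup>2"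
    by (intro tendsto_intros smalloD_tendsto small)
  then have q: "?q \<longlonglongrightarrow> 0" by (simp add: power_divide)
  have lim: "(\<lambda>n. ?q n powr (\<epsilon> / 2)) \<longlonglongrightarrow> 0"
    using \<epsilon> by (intro tendsto_zero_powrI[where b = "\<epsilon> / 2"] q tendsto_const) auto
  have lower: "\<forall>\<^sub>F n in sequentially. 0 \<le> chi_square_exponent n (k n) (\<tau> n)"
    using k \<tau> by eventually_elim (simp add: chi_square_exponent_nonneg)
  have upper: "\<forall>\<^sub>F n in sequentially. chi_square_exponent n (k n) (\<tau> n) \<le> ?q n powr (\<epsilon> / 2)"
    using k \<tau> bound
  proof eventually_elim
    case (elim n)
    let ?L = "ln (real n / (real (k n))\<^sup>2)"
    have pos: "0 < real n" "0 < real (k n) - 1" "0 < real (k n)" using elim by auto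
    have qpos: "0 < ?q n" using pos by simp
    have L: "ln (?q n) = - ?L" using pos by (simp add: ln_div)
    have "- ((2 - \<epsilon>) * ?L) / (real (k n) - 1) \<le> ln (\<tau> n)"
      using elim by (subst ln_ge_iff) auto
    then have "- ln (\<tau> n) * (real (k n) - 1) \<le> (2 - \<epsilon>) * ?L"
      using pos by (simp add: field_simps)
    then have "\<tau> n powr (- (real (k n) - 1) / 2) \<le> exp ((1 - \<epsilon> / 2) * ?L)"
      using elim by (simp add: powr_def field_simps)
    then have "chi_square_exponent n (k n) (\<tau> n) \<le> ?q n * (exp ((1 - \<epsilon> / 2) * ?L) - 1)"
      unfolding chi_square_exponent_def by (intro mult_left_mono) auto
    also have "\<dots> \<le> ?q n * exp ((1 - \<epsilon> / 2) * ?L)"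
      using qpos by (intro mult_left_mono) auto
    also have "\<dots> = exp (ln (?q n)) * exp ((1 - \<epsilon> / 2) * ?L)"
      by (simp only: exp_ln[OF qpos])
    also have "\<dots> = exp (\<epsilon> / 2 * ln (?q n))"
      unfolding L by (simp add: field_simps flip: exp_add)
    also have "\<dots> = ?q n powr (\<epsilon> / 2)"
      using qpos pos by (simp add: powr_def)
    finally show ?case .
  qed
  show "(\<lambda>n. chi_square_exponent n (k n) (\<tau> n)) \<longlonglongrightarrow> 0"
    by (rule tendsto_sandwich[OF lower upper tendsto_const lim])
qed

text \<open>Since \<open>k - 1 \<le> c ln n\<close> for either rounding, \<open>ln (n / k\<^sup>2) / (k - 1)\<close> is asymptotically at least
  \<open>1 / c\<close>, so the strict inequality \<open>t > exp (- 2 / c)\<close> leaves room for a small \<open>\<epsilon>\<close> in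
  \<open>weak_detection_impossible_small_community\<close>.\<close>

lemma weak_detection_impossible_logarithmic_community:
  assumes k: "\<forall>\<^sub>F n in sequentially. 2 \<le> k n \<and> k n \<le> n"
    and \<tau>: "\<forall>\<^sub>F n in sequentially. 0 < \<tau> n \<and> \<tau> n < 1"
    and c: "0 < c" and t: "exp (- 2 / c) < t"
    and kc: "\<forall>\<^sub>F n in sequentially. int (k n) \<in> {\<lfloor>c * ln (real n)\<rfloor>, \<lceil>c * ln (real n)\<rceil>}"
    and \<tau>t: "\<forall>\<^sub>F n in sequentially. \<tau> n = t"
  shows "weak_detection_impossible k \<tau>"
proof -
  have "\<forall>\<^sub>F n in sequentially. 0 < t \<and> t < 1"
    using \<tau> \<tau>t by eventually_elim auto
  then have t01: "0 < t" "t < 1" by (auto simp: eventually_sequentially)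
  have lnt: "- 2 / c < ln t" "ln t < 0"
    using t t01 ln_less_cancel_iff[of "exp (- 2 / c)" t] by simp_all
  have k_le: "\<forall>\<^sub>F n in sequentially. real (k n) - 1 \<le> c * ln (real n)"
    using kc by eventually_elim (auto, linarith+)
  \<comment> \<open>This choice makes \<open>(2 - \<epsilon>) / c\<close> the midpoint of \<open>- ln t\<close> and \<open>2 / c\<close>.\<close>
  define \<epsilon> where "\<epsilon> = 1 + c * ln t / 2"
  have \<epsilon>: "0 < \<epsilon>" "0 < 2 - \<epsilon>" "- ln t < (2 - \<epsilon>) * (1 / c)"
    using c lnt mult_pos_neg[of c "ln t"] by (auto simp: \<epsilon>_def field_simps)
  have small: "(\<lambda>n. real (k n)) \<in> o(\<lambda>n. sqrt (real n))"
  proof (rule landau_o.big_small_trans)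
    show "(\<lambda>n. real (k n)) \<in> O(\<lambda>n. c * ln (real n) + 1)"
      by (rule bigoI[of _ 1]) (use k_le in \<open>eventually_elim, auto\<close>)
    show "(\<lambda>n. c * ln (real n) + 1) \<in> o(\<lambda>n. sqrt (real n))"
      by real_asymp
  qed
  have "(\<lambda>n. (ln (real n) - 2 * ln (c * ln (real n) + 1)) / (c * ln (real n))) \<longlonglongrightarrow> inverse c"
    using c by real_asymp
  then have "(\<lambda>n. (2 - \<epsilon>) * ((ln (real n) - 2 * ln (c * ln (real n) + 1)) / (c * ln (real n))))
      \<longlonglongrightarrow> (2 - \<epsilon>) * (1 / c)"
    by (intro tendsto_mult tendsto_const) (simp add: inverse_eq_divide)
  from order_tendstoD(1)[OF this \<epsilon>(3)]
  have lower: "\<forall>\<^sub>F n in sequentially. - ln t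
      < (2 - \<epsilon>) * ((ln (real n) - 2 * ln (c * ln (real n) + 1)) / (c * ln (real n)))" .
  have numerator: "\<forall>\<^sub>F n in sequentially. 0 \<le> ln (real n) - 2 * ln (c * ln (real n) + 1)"
    using c by real_asymp
  have "\<forall>\<^sub>F n in sequentially.
      \<tau> n \<ge> exp (- ((2 - \<epsilon>) * ln (real n / (real (k n))\<^sup>2)) / (real (k n) - 1))"
    using k \<tau>t k_le lower numerator
  proof eventually_elim
    case (elim n)
    have pos: "0 < real n" "0 < real (k n) - 1" "0 < real (k n)" using elim by auto
    have "ln (real (k n)) \<le> ln (c * ln (real n) + 1)"
      using elim pos by (subst ln_le_cancel_iff) auto
    then have num: "ln (real n) - 2 * ln (c * ln (real n) + 1) \<le> ln (real n / (real (k n))\<^sup>2)"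
      using pos by (simp add: ln_div ln_realpow)
    then have L0: "0 \<le> ln (real n / (real (k n))\<^sup>2)" using elim by linarith
    have "- ln t \<le> (2 - \<epsilon>) * ((ln (real n) - 2 * ln (c * ln (real n) + 1)) / (c * ln (real n)))"
      using elim by simp
    also have "\<dots> \<le> (2 - \<epsilon>) * (ln (real n / (real (k n))\<^sup>2) / (real (k n) - 1))"
      using elim(3) num L0 pos \<epsilon>(2) by (intro mult_left_mono frac_le) simp_all
    finally have "- ((2 - \<epsilon>) * ln (real n / (real (k n))\<^sup>2)) / (real (k n) - 1) \<le> ln t"
      by simp
    then show ?case using t01 elim by (subst (asm) ln_ge_iff) auto
  qed
  with small \<epsilon>(1) show ?thesis
    by (intro weak_detection_impossible_small_community[OF k \<tau>])
qed

text \<open>Put \<open>Y = ln (1 + \<epsilon>\<^sub>n n / k\<^sup>2)\<close>. Because \<open>Y = O(ln n)\<close> and \<open>k / ln n\<close> is unbounded, the hypothesis forces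
  \<open>\<tau> \<ge> 1 - \<epsilon>\<close> eventually. The factor \<open>1 - \<epsilon>\<close> in the hypothesis then pays for replacing \<open>1 - \<tau>\<close> by
  \<open>- ln \<tau> \<le> (1 - \<tau>) / \<tau>\<close>, and \<open>\<tau> powr (- (k - 1) / 2) \<le> exp Y\<close> follows.\<close>

lemma weak_detection_impossible_large_community:
  assumes k: "\<forall>\<^sub>F n in sequentially. 2 \<le> k n \<and> k n \<le> n"
    and \<tau>: "\<forall>\<^sub>F n in sequentially. 0 < \<tau> n \<and> \<tau> n < 1"
    and large: "filterlim (\<lambda>n. real (k n) / ln (real n)) at_top sequentially"
    and \<epsilon>: "0 < \<epsilon>" and \<epsilon>'_pos: "\<And>n. 0 < \<epsilon>' n" and \<epsilon>'_lim: "\<epsilon>' \<longlonglongrightarrow> 0"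
    and bound: "\<forall>\<^sub>F n in sequentially.
      \<tau> n \<ge> 1 - 2 * (1 - \<epsilon>) / (real (k n) - 1) * ln (1 + \<epsilon>' n * real n / (real (k n))\<^sup>2)"
  shows "weak_detection_impossible k \<tau>"
proof (rule weak_detection_impossibleI[OF k \<tau>])
  \<comment> \<open>The constant \<open>8\<close>: \<open>1 - \<tau> \<le> 2 Y / (k - 1)\<close>, where \<open>Y \<le> 2 ln n\<close> and \<open>k - 1 \<ge> k / 2\<close>.\<close>
  have "\<forall>\<^sub>F n in sequentially. 8 / \<epsilon> \<le> real (k n) / ln (real n)"
    using large by (simp add: filterlim_at_top)
  moreover have "\<forall>\<^sub>F n in sequentially. \<epsilon>' n < 1"
    using order_tendstoD(2)[OF \<epsilon>'_lim, of 1] by simp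
  ultimately have upper: "\<forall>\<^sub>F n in sequentially. chi_square_exponent n (k n) (\<tau> n) \<le> \<epsilon>' n"
    using k \<tau> bound
  proof eventually_elim
    case (elim n)
    define Y where "Y = ln (1 + \<epsilon>' n * real n / (real (k n))\<^sup>2)"
    have pos: "0 < real n" "2 \<le> real (k n)" "1 < real n" using elim by auto
    have arg: "0 \<le> \<epsilon>' n * real n / (real (k n))\<^sup>2" using \<epsilon>'_pos[of n] by simp
    then have Y0: "0 \<le> Y" by (simp add: Y_def)
    have \<tau>_gap: "1 - \<tau> n \<le> 2 * (1 - \<epsilon>) * Y / (real (k n) - 1)"
      using elim by (simp add: Y_def)
    \<comment> \<open>For \<open>\<epsilon> \<ge> 1\<close> the hypothesis would force \<open>\<tau> \<ge> 1\<close>.\<close>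
    have \<epsilon>1: "\<epsilon> < 1"
    proof (rule ccontr)
      assume "\<not> \<epsilon> < 1"
      then have "2 * (1 - \<epsilon>) * Y / (real (k n) - 1) \<le> 0"
        using mult_nonpos_nonneg[of "2 * (1 - \<epsilon>)" Y] Y0 pos by (intro divide_nonpos_nonneg) auto
      then show False using \<tau>_gap elim by linarith
    qed
    have "\<epsilon>' n * real n / (real (k n))\<^sup>2 \<le> real n"
    proof -
      have "\<epsilon>' n * real n \<le> 1 * real n" using elim by (intro mult_right_mono) auto
      also have "\<dots> \<le> real n * (real (k n))\<^sup>2"
        using pos by (simp add: mult_le_cancel_left1 one_le_power)
      finally show ?thesis using pos by (simp add: divide_le_eq)
    qed
    then have "Y \<le> ln ((real n)\<^sup>2)"
    proof -
      have "real n * 2 \<le> real n * real n" using elim by (intro mult_left_mono) auto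
      then have "1 + real n \<le> (real n)\<^sup>2" using pos unfolding power2_eq_square by linarith
      with \<open>_ \<le> real n\<close> show ?thesis unfolding Y_def using arg pos
        by (subst ln_le_cancel_iff) auto
    qed
    then have Y_le: "Y \<le> 2 * ln (real n)" using pos by (simp add: ln_realpow)
    have ln_pos: "0 < ln (real n)" using pos by simp
    have "1 - \<epsilon> \<le> \<tau> n"
    proof -
      have "8 * ln (real n) \<le> \<epsilon> * real (k n)"
        using elim(1) ln_pos \<epsilon> by (simp add: field_simps)
      moreover have "\<epsilon> * real (k n) \<le> \<epsilon> * (2 * (real (k n) - 1))"
        using pos \<epsilon> by (intro mult_left_mono) auto
      moreover have "2 * (1 - \<epsilon>) * Y \<le> 2 * Y" using Y0 \<epsilon> by (intro mult_right_mono) auto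
      ultimately have "2 * (1 - \<epsilon>) * Y \<le> \<epsilon> * (real (k n) - 1)" using Y_le by linarith
      then have "2 * (1 - \<epsilon>) * Y / (real (k n) - 1) \<le> \<epsilon>" using pos by (simp add: divide_le_eq)
      then show ?thesis using \<tau>_gap by linarith
    qed
    have "- ln (\<tau> n) \<le> (1 - \<tau> n) / \<tau> n"
      using ln_le_minus_one[of "1 / \<tau> n"] elim by (simp add: ln_div field_simps)
    also have "\<dots> \<le> (2 * (1 - \<epsilon>) * Y / (real (k n) - 1)) / (1 - \<epsilon>)"
      using \<tau>_gap \<open>1 - \<epsilon> \<le> \<tau> n\<close> \<epsilon>1 elim by (intro frac_le) auto
    also have "\<dots> = 2 * Y / (real (k n) - 1)"
    proof -
      have "2 * w * Y / m / w = 2 * Y / m" if "w \<noteq> 0" for w m :: real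
        using that by simp
      from this[of "1 - \<epsilon>"] show ?thesis using \<epsilon>1 by force
    qed
    finally have "- ln (\<tau> n) * (real (k n) - 1) \<le> 2 * Y" using pos by (simp add: pos_le_divide_eq)
    then have "\<tau> n powr (- (real (k n) - 1) / 2) \<le> exp Y"
      using elim by (simp add: powr_def field_simps)
    then have "chi_square_exponent n (k n) (\<tau> n) \<le> (real (k n))\<^sup>2 / real n * (exp Y - 1)"
      unfolding chi_square_exponent_def by (intro mult_left_mono) auto
    also have "\<dots> = \<epsilon>' n" using arg pos by (simp add: Y_def add_pos_nonneg)
    finally show ?case .
  qed
  have "\<forall>\<^sub>F n in sequentially. 0 \<le> chi_square_exponent n (k n) (\<tau> n)"
    using k \<tau> by eventually_elim (simp add: chi_square_exponent_nonneg)
  then show "(\<lambda>n. chi_square_exponent n (k n) (\<tau> n)) \<longlonglongrightarrow> 0"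
    by (rule tendsto_sandwich[OF _ upper tendsto_const \<epsilon>'_lim])
qed

theorem corollary6:
  fixes k :: "nat \<Rightarrow> nat" and \<tau> :: "nat \<Rightarrow> real"
  assumes "\<forall>\<^sub>F n in sequentially. 2 \<le> k n \<and> k n \<le> n"
    and "\<forall>\<^sub>F n in sequentially. 0 < \<tau> n \<and> \<tau> n < 1"
  shows
    "((\<exists>c t. c > 0 \<and> t > exp (- 2 / c) \<and>
        (\<forall>\<^sub>F n in sequentially. int (k n) \<in> {\<lfloor>c * ln (real n)\<rfloor>, \<lceil>c * ln (real n)\<rceil>}) \<and>
        (\<forall>\<^sub>F n in sequentially. \<tau> n = t))
      \<longrightarrow> weak_detection_impossible k \<tau>)
   \<and> ((\<lambda>n. real (k n)) \<in> o(\<lambda>n. sqrt (real n)) \<and>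
      (\<exists>\<epsilon>>0. \<forall>\<^sub>F n in sequentially.
         \<tau> n \<ge> exp (- ((2 - \<epsilon>) * ln (real n / (real (k n))\<^sup>2)) / (real (k n) - 1)))
      \<longrightarrow> weak_detection_impossible k \<tau>)
   \<and> (filterlim (\<lambda>n. real (k n) / ln (real n)) at_top sequentially \<and>
      (\<exists>\<epsilon>>0. \<exists>\<epsilon>' :: nat \<Rightarrow> real. (\<forall>n. \<epsilon>' n > 0) \<and> \<epsilon>' \<longlonglongrightarrow> 0 \<and>
         (\<forall>\<^sub>F n in sequentially.
           \<tau> n \<ge> 1 - 2 * (1 - \<epsilon>) / (real (k n) - 1) * ln (1 + \<epsilon>' n * real n / (real (k n))\<^sup>2)))
      \<longrightarrow> weak_detection_impossible k \<tau>)"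
proof (intro conjI impI)
  assume "\<exists>c t. c > 0 \<and> t > exp (- 2 / c) \<and>
        (\<forall>\<^sub>F n in sequentially. int (k n) \<in> {\<lfloor>c * ln (real n)\<rfloor>, \<lceil>c * ln (real n)\<rceil>}) \<and>
        (\<forall>\<^sub>F n in sequentially. \<tau> n = t)"
  then show "weak_detection_impossible k \<tau>"
    by (elim exE conjE) (rule weak_detection_impossible_logarithmic_community[OF assms])
next
  assume "(\<lambda>n. real (k n)) \<in> o(\<lambda>n. sqrt (real n)) \<and>
      (\<exists>\<epsilon>>0. \<forall>\<^sub>F n in sequentially.
         \<tau> n \<ge> exp (- ((2 - \<epsilon>) * ln (real n / (real (k n))\<^sup>2)) / (real (k n) - 1)))"
  then show "weak_detection_impossible k \<tau>"
    by (elim exE conjE) (rule weak_detection_impossible_small_community[OF assms])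
next
  assume "filterlim (\<lambda>n. real (k n) / ln (real n)) at_top sequentially \<and>
      (\<exists>\<epsilon>>0. \<exists>\<epsilon>' :: nat \<Rightarrow> real. (\<forall>n. \<epsilon>' n > 0) \<and> \<epsilon>' \<longlonglongrightarrow> 0 \<and>
         (\<forall>\<^sub>F n in sequentially.
           \<tau> n \<ge> 1 - 2 * (1 - \<epsilon>) / (real (k n) - 1) * ln (1 + \<epsilon>' n * real n / (real (k n))\<^sup>2)))"
  then show "weak_detection_impossible k \<tau>"
    by (elim exE conjE) (rule weak_detection_impossible_large_community[OF assms], auto)
qed

end
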